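(* Let $\Omega$ be an infinite set such that $|\Omega|$ has uncountable cofinality, and suppose that $\Omega^\Omega$ is a semitopological semigroup with respect to a locally compact topology $\mathcal{T}$. Then $\mathcal{T}$ is either not perfect or not $T_1$.
   Context: $\Omega^\Omega$ is the monoid of all functions $\Omega\to\Omega$ under composition. A semigroup $S$ with a topology is semitopological if for every $s\in S$ the maps $x\mapsto xs$ and $x\mapsto sx$ are continuous maps $S\to S$. A topology is locally compact if every point has an open neighbourhood that is contained in some compact set, and perfect if it has no isolated points (points $x$ with $\{x\}$ open). The cofinality of a cardinal $\mu$ is the least cardinal $\lambda$ such that $\mu$ is the union of $\lambda$ cardinals each smaller than $\mu$. *)

theory Defs
  imports "HOL-Analysis.Analysis"
begin

unbundle cardinal_syntax

text \<open>
  As in the library, a cardinal is a relation \<^term>\<open>r\<close> with \<^term>\<open>Card_order r\<close>, considered up to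
  \<^term>\<open>ordIso\<close>, and its underlying set is \<^term>\<open>Field r\<close>. ``\<open>\<mu>\<close> is the union of \<open>\<lambda>\<close>
  cardinals each smaller than \<open>\<mu>\<close>'' is read as: a set of size \<open>\<mu>\<close> is the union of a family,
  indexed by a set of size \<open>\<lambda>\<close>, of sets each of cardinality smaller than \<open>\<mu>\<close>. (With von Neumann
  cardinals taken literally, a successor cardinal would never be such a union.)
\<close>

definition union_of_smaller :: "'a rel \<Rightarrow> 'b rel \<Rightarrow> bool" where
  "union_of_smaller r l \<longleftrightarrow>
     (\<exists>A. Field r = (\<Union>i\<in>Field l. A i) \<and> (\<forall>i\<in>Field l. |A i| <o r))"

text \<open>
  An infinite cardinal is the union of its singletons, so its cofinality is at most itself and
  the least \<open>\<lambda>\<close> may be sought among the cardinals on the same type.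
\<close>

definition is_cofinality :: "'a rel \<Rightarrow> 'a rel \<Rightarrow> bool" where
  "is_cofinality r l \<longleftrightarrow>
     Card_order l \<and> union_of_smaller r l \<and>
     (\<forall>l' :: 'a rel. Card_order l' \<and> union_of_smaller r l' \<longrightarrow> l \<le>o l')"

definition cofinality :: "'a rel \<Rightarrow> 'a rel" where
  "cofinality r = (SOME l. is_cofinality r l)"

lemma is_cofinality_cofinality:
  fixes r :: "'a rel"
  assumes r: "Card_order r" and inf: "infinite (Field r)"
  shows "is_cofinality r (cofinality r)"
proof -
  let ?R = "{l :: 'a rel. Card_order l \<and> union_of_smaller r l}"
  have "|{x}| <o r" for x :: 'a
    using r inf by (intro finite_ordLess_infinite) (auto simp: card_order_on_well_order_on card_of_well_order_on Field_card_of)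
  then have "union_of_smaller r r"
    unfolding union_of_smaller_def by (intro exI[of _ "\<lambda>x. {x}"]) auto
  then have "?R \<noteq> {}"
    using r by auto
  then have "\<exists>l\<in>?R. \<forall>l'\<in>?R. l \<le>o l'"
    by (intro exists_minim_Card_order) auto
  then have "\<exists>l. is_cofinality r l"
    unfolding is_cofinality_def by auto
  then show ?thesis
    unfolding cofinality_def by (rule someI_ex)
qed

lemma is_cofinality_unique:
  assumes "is_cofinality r l" and "is_cofinality r l'"
  shows "(l, l') \<in> ordIso"
  using assms unfolding is_cofinality_def by (simp add: ordIso_iff_ordLeq)

definition semitopological_semigroup :: "'s topology \<Rightarrow> ('s \<Rightarrow> 's \<Rightarrow> 's) \<Rightarrow> bool" where
  "semitopological_semigroup T m \<longleftrightarrow>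
     (\<forall>x\<in>topspace T. \<forall>y\<in>topspace T. m x y \<in> topspace T) \<and>
     (\<forall>x\<in>topspace T. \<forall>y\<in>topspace T. \<forall>z\<in>topspace T. m (m x y) z = m x (m y z)) \<and>
     (\<forall>s\<in>topspace T. continuous_map T T (\<lambda>x. m x s) \<and> continuous_map T T (\<lambda>x. m s x))"

definition perfect_space :: "'s topology \<Rightarrow> bool" where
  "perfect_space T \<longleftrightarrow> (\<forall>x\<in>topspace T. \<not> openin T {x})"

end

theory Submission
  imports Defs
begin

text \<open>
  A \<open>T\<^sub>1\<close> topology refines the topology of pointwise convergence, so a compact neighbourhood of a
  constant map takes only finitely many values at each point. As the cofinality is uncountable,
  some \<open>n\<close> bounds the number of these values at \<open>|\<Omega>|\<close> many points. Pulling the neighbourhood back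
  along \<open>g \<mapsto> s \<circ> g\<close>, for an injection \<open>s\<close> that fixes the constant and misses another value at
  \<open>|\<Omega>|\<close> many points, lowers \<open>n\<close> by one. Once \<open>n = 1\<close>, pulling back along \<open>g \<mapsto> g \<circ> p\<close>, for \<open>p\<close>
  mapping these points onto \<open>\<Omega>\<close>, isolates the constant map.
\<close>

lemma union_big_imp_big:
  fixes A B :: "'a set"
  assumes "infinite (UNIV :: 'a set)" and "|UNIV :: 'a set| \<le>o |A \<union> B|"
  shows "|UNIV :: 'a set| \<le>o |A| \<or> |UNIV :: 'a set| \<le>o |B|"
proof (rule ccontr)
  assume "\<not> ?thesis"
  then have "|A| <o |UNIV :: 'a set|" "|B| <o |UNIV :: 'a set|"
    using card_of_Well_order not_ordLeq_iff_ordLess by blast+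
  then have "|A \<union> B| <o |UNIV :: 'a set|"
    by (rule card_of_Un_ordLess_infinite[OF assms(1)])
  with assms(2) show False
    by (simp add: not_ordLess_ordLeq)
qed

text \<open>The complement of \<open>a\<close> is infinite, hence equipotent with two disjoint
  copies of itself; \<open>s\<close> and \<open>t\<close> embed one copy each and fix
  \<open>a\<close>. Any value other than \<open>a\<close> is then missed by at least one of the two
  injections.\<close>

lemma ex_two_injections_meeting_in_point:
  fixes a :: 'a
  assumes "infinite (UNIV :: 'a set)"
  obtains s t :: "'a \<Rightarrow> 'a"
  where "inj s" "inj t" "s a = a" "t a = a" "range s \<inter> range t = {a}"
proof -
  let ?B = "UNIV - {a}"
  have "infinite ?B"
    using assms by simp
  then have "|(?B <+> ?B)| =o |?B|"
    using card_of_Plus_infinite1 card_of_mono1 by blast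
  then obtain f where f: "bij_betw f (?B <+> ?B) ?B"
    using card_of_ordIso by blast
  have inj: "f u = f v \<longleftrightarrow> u = v" if "u \<in> ?B <+> ?B" "v \<in> ?B <+> ?B" for u v
    using f that by (meson bij_betw_def inj_on_eq_iff)
  have ne: "f u \<noteq> a" if "u \<in> ?B <+> ?B" for u
    using f that by (auto dest: bij_betwE)
  define s where "s x = (if x = a then a else f (Inl x))" for x
  define t where "t x = (if x = a then a else f (Inr x))" for x
  have neL: "f (Inl x) \<noteq> a" "f (Inr x) \<noteq> a" if "x \<noteq> a" for x
    using ne[of "Inl x"] ne[of "Inr x"] that by auto
  have "s x = s y \<longleftrightarrow> x = y" "t x = t y \<longleftrightarrow> x = y" for x y
    using neL[of x] neL[of y] neL[of x, symmetric] neL[of y, symmetric] inj[of "Inl x" "Inl y"] inj[of "Inr x" "Inr y"]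
    unfolding s_def t_def by auto
  then have st: "inj s" "inj t"
    by (auto intro: injI)
  have sa: "s a = a" "t a = a"
    by (simp_all add: s_def t_def)
  have "x = a" if "s x = t y" for x y
    using that neL[of x] neL[of y] inj[of "Inl x" "Inr y"] unfolding s_def t_def
    by (auto split: if_splits)
  then have "range s \<inter> range t \<subseteq> {a}"
    using sa by fastforce
  moreover have "a \<in> range s" "a \<in> range t"
    using sa by (metis rangeI)+
  ultimately show thesis
    using st sa that by blast
qed

text \<open>Otherwise the countably many fibres of \<open>c\<close> would present the whole type as
  a countable union of smaller sets, making the cofinality countable.\<close>

lemma uncountable_cofinality_big_fibre:
  fixes c :: "'a \<Rightarrow> nat"
  assumes inf: "infinite (UNIV :: 'a set)"
    and cof: "uncountable (Field (cofinality |UNIV :: 'a set| ))"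
  shows "\<exists>n. |UNIV :: 'a set| \<le>o |c -` {n}|"
proof (rule ccontr)
  assume "\<not> ?thesis"
  then have small: "|c -` {n}| <o |UNIV :: 'a set|" for n
    using card_of_Well_order not_ordLeq_iff_ordLess by blast
  \<comment> \<open>The cofinality is minimal only among cardinals on the type \<open>'a\<close>, so
    the index set of natural numbers is copied into \<open>'a\<close>.\<close>
  obtain e :: "nat \<Rightarrow> 'a" where e: "inj e"
    using inf infinite_countable_subset by blast
  have "union_of_smaller |UNIV :: 'a set| |range e|"
    unfolding union_of_smaller_def
    by (intro exI[of _ "\<lambda>i. c -` {inv e i}"]) (use e small in \<open>auto simp: Field_card_of\<close>)
  moreover have "is_cofinality |UNIV :: 'a set| (cofinality |UNIV :: 'a set| )"
    using inf by (intro is_cofinality_cofinality card_of_Card_order) (simp add: Field_card_of)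
  ultimately have "cofinality |UNIV :: 'a set| \<le>o |range e|"
    and "Card_order (cofinality |UNIV :: 'a set| )"
    unfolding is_cofinality_def by (simp_all add: card_of_Card_order)
  then have "|Field (cofinality |UNIV :: 'a set| )| \<le>o |range e|"
    using ordIso_ordLeq_trans[OF card_of_Field_ordIso] by simp
  then have "\<exists>g. inj_on g (Field (cofinality |UNIV :: 'a set| )) \<and>
      g ` Field (cofinality |UNIV :: 'a set| ) \<subseteq> range e"
    by (rule card_of_ordLeq[THEN iffD2])
  then have "countable (Field (cofinality |UNIV :: 'a set| ))"
    using countable_subset[OF _ countable_image[OF countableI_type]] countable_image_inj_on by metis
  with cof show False
    by simp
qed

context
  fixes T :: "('a \<Rightarrow> 'a) topology"
  assumes top: "topspace T = UNIV"
    and semi: "semitopological_semigroup T (\<circ>)"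
begin

lemma continuous_map_comp_right: "continuous_map T T (\<lambda>g. g \<circ> p)"
  and continuous_map_comp_left: "continuous_map T T (\<lambda>g. s \<circ> g)"
  using semi top unfolding semitopological_semigroup_def by auto

lemma openin_comp_right:
  assumes "openin T W"
  shows "openin T {g. g \<circ> p \<in> W}"
  using openin_continuous_map_preimage[OF continuous_map_comp_right assms] top by simp

lemma openin_comp_left:
  assumes "openin T W"
  shows "openin T {g. s \<circ> g \<in> W}"
  using openin_continuous_map_preimage[OF continuous_map_comp_left assms] top by simp

text \<open>This is where \<open>T\<close> is seen to refine the topology of pointwise convergence:
  the complement of the fibre is the preimage of a single constant map, closed by
  \<open>t1_space\<close>, under a composite of translations.\<close>

lemma openin_evaluation_fibre:
  assumes t1: "t1_space T" and "infinite (UNIV :: 'a set)"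
  shows "openin T {f. f x = b}"
proof -
  obtain c where c: "c \<noteq> b"
    using assms(2) by (metis ex_new_if_finite finite.simps singleton_iff)
  \<comment> \<open>Precomposing with the constant map to \<open>x\<close> turns \<open>f\<close>
    into the constant map with value \<open>f x\<close>; then \<open>h\<close> merges all values
    other than \<open>b\<close> into \<open>c\<close>.\<close>
  define h where "h z = (if z = b then b else c)" for z
  have "continuous_map T T (\<lambda>f. h \<circ> (f \<circ> (\<lambda>_ :: 'a. x)))"
    using continuous_map_compose[OF continuous_map_comp_right continuous_map_comp_left]
    by (simp add: comp_def)
  moreover have "closedin T {\<lambda>_. c}"
    using t1 top by (simp add: t1_space_closedin_singleton)
  ultimately have "closedin T {f \<in> topspace T. h \<circ> (f \<circ> (\<lambda>_ :: 'a. x)) \<in> {\<lambda>_. c}}"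
    by (rule closedin_continuous_map_preimage)
  also have "{f \<in> topspace T. h \<circ> (f \<circ> (\<lambda>_ :: 'a. x)) \<in> {\<lambda>_. c}} = UNIV - {f. f x = b}"
    using c top by (auto simp: h_def fun_eq_iff)
  finally show ?thesis
    using top openin_closedin_eq by fastforce
qed

text \<open>The fibres of evaluation at \<open>x\<close> form an open cover, and a finite subcover
  of \<open>K\<close> leaves only finitely many values.\<close>

lemma compactin_finite_values:
  assumes "t1_space T" and "infinite (UNIV :: 'a set)" and K: "compactin T K"
  shows "finite ((\<lambda>g. g x) ` K)"
proof -
  let ?\<U> = "range (\<lambda>b. {f :: 'a \<Rightarrow> 'a. f x = b})"
  have "\<forall>U \<in> ?\<U>. openin T U"
    using openin_evaluation_fibre[OF assms(1,2)] by blast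
  moreover have "K \<subseteq> \<Union>?\<U>"
    by auto
  ultimately obtain \<F> where \<F>: "finite \<F>" "\<F> \<subseteq> ?\<U>" "K \<subseteq> \<Union>\<F>"
    using K unfolding compactin_def by meson
  then obtain B where B: "finite B" "\<F> = (\<lambda>b. {f. f x = b}) ` B"
    by (meson finite_subset_image)
  have "(\<lambda>g. g x) ` K \<subseteq> B"
    using \<F>(3) B(2) by auto
  with B(1) show ?thesis
    by (rule finite_subset[rotated])
qed

text \<open>Induction on the bound \<open>n\<close>, with \<open>W\<close> and \<open>A\<close>
  varying. For \<open>n = 0\<close> the hypotheses clash, since the constant map provides a value at
  each point of the nonempty set \<open>A\<close>.\<close>

lemma isolated_constant:
  assumes inf: "infinite (UNIV :: 'a set)"
    and "openin T W" "(\<lambda>_. a) \<in> W" "|UNIV :: 'a set| \<le>o |A|"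
    and "\<And>y. y \<in> A \<Longrightarrow> finite ((\<lambda>g. g y) ` W) \<and> card ((\<lambda>g. g y) ` W) \<le> n"
  shows "openin T {\<lambda>_. a}"
  using assms(2-)
proof (induction n arbitrary: W A)
  case 0
  then have "A \<noteq> {}"
    by (metis UNIV_not_empty card_of_empty3)
  then obtain y where y: "y \<in> A"
    by blast
  have "(\<lambda>g. g y) ` W \<noteq> {}"
    using 0(2) by blast
  with 0(4)[OF y] show ?case
    by (simp add: card_eq_0_iff)
next
  case (Suc n)
  \<comment> \<open>If \<open>A1\<close> is large, the constant map is isolated at once, whatever
    \<open>n\<close> is; if \<open>A2\<close> is large, there are enough points with a second value
    to remove.\<close>
  define A1 where "A1 = {y \<in> A. (\<lambda>g. g y) ` W \<subseteq> {a}}"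
  define A2 where "A2 = A - A1"
  have "|UNIV :: 'a set| \<le>o |A1 \<union> A2|"
    using Suc.prems(3) by (simp add: A1_def A2_def Un_absorb1)
  then consider "|UNIV :: 'a set| \<le>o |A1|" | "|UNIV :: 'a set| \<le>o |A2|"
    using union_big_imp_big[OF inf] by blast
  then show ?case
  proof cases
    case 1
    then have "\<exists>p. p ` A1 = (UNIV :: 'a set)"
      by (rule card_of_ordLeq2[OF UNIV_not_empty, THEN iffD2])
    \<comment> \<open>Values of \<open>p\<close> outside \<open>A1\<close> do not matter:
      \<open>g \<circ> p \<in> W\<close> already forces \<open>g\<close> to be \<open>a\<close> on
      the image of \<open>A1\<close>, which is everything.\<close>
    then obtain p where p: "p ` A1 = (UNIV :: 'a set)" ..
    have "g = (\<lambda>_. a)" if "g \<circ> p \<in> W" for g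
    proof
      fix x
      have "x \<in> p ` A1"
        using p by simp
      then obtain y where y: "y \<in> A1" "x = p y" ..
      then have "(g \<circ> p) y \<in> {a}"
        using that unfolding A1_def by blast
      then show "g x = a"
        using y by simp
    qed
    moreover have "(\<lambda>_. a) \<circ> p \<in> W"
      using Suc.prems(2) by (simp add: comp_def)
    ultimately have "{g. g \<circ> p \<in> W} = {\<lambda>_. a}"
      by blast
    then show ?thesis
      using openin_comp_right[OF Suc.prems(1), of p] by simp
  next
    case 2
    have "\<forall>y\<in>A2. \<exists>b. b \<in> (\<lambda>g. g y) ` W \<and> b \<noteq> a"
      unfolding A1_def A2_def by blast
    then obtain b where b: "\<And>y. y \<in> A2 \<Longrightarrow> b y \<in> (\<lambda>g. g y) ` W \<and> b y \<noteq> a"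
      by metis
    \<comment> \<open>Passing to the \<open>g\<close> with \<open>s \<circ> g \<in> W\<close> lowers
      the bound: \<open>s\<close> maps their values at \<open>y\<close> injectively into those of
      \<open>W\<close>, never hitting \<open>b y\<close>.\<close>
    have reduce: ?thesis
      if s: "inj s" "s a = a" and big: "|UNIV :: 'a set| \<le>o |{y \<in> A2. b y \<notin> range s}|" for s
    proof (rule Suc.IH[OF openin_comp_left[OF Suc.prems(1), of s] _ big])
      show "(\<lambda>_. a) \<in> {g. s \<circ> g \<in> W}"
        using s(2) Suc.prems(2) by (simp add: comp_def)
      fix y assume y: "y \<in> {y \<in> A2. b y \<notin> range s}"
      let ?V = "(\<lambda>g. g y) ` {g. s \<circ> g \<in> W}" and ?Wy = "(\<lambda>g. g y) ` W"
      have "y \<in> A"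
        using y by (simp add: A2_def)
      then have W: "finite ?Wy" "card ?Wy \<le> Suc n"
        using Suc.prems(4) by auto
      have "s (g y) \<in> ?Wy - {b y}" if "s \<circ> g \<in> W" for g
      proof
        show "s (g y) \<in> ?Wy"
          using that by (rule rev_image_eqI) simp
        show "s (g y) \<notin> {b y}"
        proof
          assume "s (g y) \<in> {b y}"
          then have "b y = s (g y)"
            by simp
          then have "b y \<in> range s"
            by (rule range_eqI)
          with y show False
            by simp
        qed
      qed
      then have sub: "s ` ?V \<subseteq> ?Wy - {b y}"
        by (intro image_subsetI) (elim imageE, simp)
      have injV: "inj_on s ?V"
        by (rule inj_on_subset[OF s(1) subset_UNIV])
      have fin: "finite (?Wy - {b y})"
        using W(1) by (rule finite_Diff)
      have "finite ?V"
        by (rule inj_on_finite[OF injV sub fin])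
      moreover have "card ?V \<le> card (?Wy - {b y})"
        by (rule card_inj_on_le[OF injV sub fin])
      moreover have "card (?Wy - {b y}) \<le> n"
      proof -
        have "b y \<in> ?Wy"
          using b[of y] y by simp
        then show ?thesis
          using W(2) by (simp only: card_Diff_singleton)
      qed
      ultimately show "finite ?V \<and> card ?V \<le> n"
        by simp
    qed
    obtain s t where st: "inj s" "inj t" "s a = a" "t a = a" "range s \<inter> range t = {a}"
      using ex_two_injections_meeting_in_point[OF inf] by blast
    \<comment> \<open>The ranges share only \<open>a\<close>, so each \<open>b y\<close> is missed
      by \<open>s\<close> or by \<open>t\<close>, and one of them misses it at as many points as the
      type has elements.\<close>
    have "b y \<notin> range s \<inter> range t" if "y \<in> A2" for y
      using b[OF that] st(5) by simp
    then have "A2 = {y \<in> A2. b y \<notin> range s} \<union> {y \<in> A2. b y \<notin> range t}"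
      by auto
    with 2 have "|UNIV :: 'a set| \<le>o |{y \<in> A2. b y \<notin> range s} \<union> {y \<in> A2. b y \<notin> range t}|"
      by simp
    then show ?thesis
      using union_big_imp_big[OF inf] reduce[OF st(1,3)] reduce[OF st(2,4)] by blast
  qed
qed

end

theorem theorem6p4:
  fixes T :: "('a \<Rightarrow> 'a) topology"
  assumes "infinite (UNIV :: 'a set)"
    and "uncountable (Field (cofinality |UNIV :: 'a set| ))"
    and "topspace T = UNIV"
    and "semitopological_semigroup T (\<circ>)"
    and "locally_compact_space T"
  shows "\<not> perfect_space T \<or> \<not> t1_space T"
proof (rule ccontr)
  assume "\<not> ?thesis"
  then have perfect: "perfect_space T" and t1: "t1_space T"
    by auto
  fix a :: 'a
  obtain W K where W: "openin T W" "(\<lambda>_. a) \<in> W" "compactin T K" "W \<subseteq> K"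
    using assms(5) unfolding locally_compact_space_def assms(3) by (meson UNIV_I)
  \<comment> \<open>The induction needs an open set, so finiteness is passed from the compact
    \<open>K\<close> down to \<open>W\<close>.\<close>
  have fin: "finite ((\<lambda>g. g y) ` W)" for y
    using compactin_finite_values[OF assms(3,4) t1 assms(1) W(3)] W(4)
    by (meson finite_subset image_mono)
  obtain n where "|UNIV :: 'a set| \<le>o |(\<lambda>y. card ((\<lambda>g. g y) ` W)) -` {n}|"
    using uncountable_cofinality_big_fibre[OF assms(1,2)] by blast
  then have "openin T {\<lambda>_. a}"
    by (rule isolated_constant[where n = n, OF assms(3,4,1) W(1,2)]) (use fin in auto)
  then show False
    using perfect assms(3) by (simp add: perfect_space_def)
qed

end
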